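(* Let $\alpha\ge 0$ and let $q$ be an $\alpha$-LDP mechanism between the finite spaces $\mathcal{X}=\{x_1,\dots,x_d\}$ and $\mathcal{Z}=\{z_1,\dots,z_l\}$. Let $\mathcal{E}=\{0,\dots,2^d-1\}$. Then there exist an extremal mechanism $q^{(1)}$ from $\mathcal{X}$ to $\mathcal{E}$ and a randomization mechanism $q^{(2)}$ from $\mathcal{E}$ to $\mathcal{Z}$ such that $q=q^{(2)}\circ q^{(1)}$. Moreover, $q^{(1)}$ has the representation $q^{(1)}_x(\beta)=\omega_\beta\, r_\beta(x)$ for all $x\in\mathcal{X}$, $\beta\in\mathcal{E}$, where $(\omega_\beta)_{\beta\in\mathcal{E}}$ defines a sub-probability measure on $\mathcal{E}$ satisfying $e^{-\alpha}\le\sum_{\beta=0}^{2^d-1}\omega_\beta\le 1$.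
   Context: A randomization (privacy) mechanism $q$ from a finite set $\mathcal{X}$ to a finite set $\mathcal{Z}$ is a family $(q_x)_{x\in\mathcal{X}}$ of probability mass functions on $\mathcal{Z}$; $q_x(z)=P(Z=z\mid X=x)$. It is $\alpha$-LDP (locally differentially private) if $q_x(z)\le e^{\alpha}q_{x'}(z)$ for all $x,x'\in\mathcal{X}$, $z\in\mathcal{Z}$. It is extremal (for the level $\alpha$) if $q_{x'}(z)/q_x(z)\in\{e^{-\alpha},1,e^{\alpha}\}$ for all $z$ and all $x,x'$, with the convention that if $q_x(z)=0$ for some $x$ the requirement reads $q_{x'}(z)=0$ for all $x'$. Composition: for $q^{(1)}$ from $\mathcal{X}$ to $\mathcal{E}$ and $q^{(2)}$ from $\mathcal{E}$ to $\mathcal{Z}$, $(q^{(2)}\circ q^{(1)})_x(z)=\sum_{y\in\mathcal{E}}q^{(1)}_x(y)\,q^{(2)}_y(z)$. Staircase patterns: for $\beta\in\{0,\dots,2^d-1\}$ write $\beta=\sum_{j=0}^{d-1}d_j(\beta)2^j$ with $d_j(\beta)\in\{0,1\}$. The function $r_\beta:\mathcal{X}\to\{1,e^\alpha\}$ is defined by $r_\beta(x_{j+1})=1$ if $d_j(\beta)=0$ and $r_\beta(x_{j+1})=e^\alpha$ if $d_j(\beta)=1$, for $j=0,\dots,d-1$. *)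

theory Defs
  imports "HOL-Probability.Probability_Mass_Function"
begin

text \<open>
  A mechanism between finite sets is a family of probability mass functions indexed by the source
  and supported in the target. Values of the family outside the source carry no meaning.
\<close>

definition mechanism :: "'x set \<Rightarrow> 'z set \<Rightarrow> ('x \<Rightarrow> 'z pmf) \<Rightarrow> bool" where
  "mechanism X Z q \<longleftrightarrow> (\<forall>x\<in>X. set_pmf (q x) \<subseteq> Z)"

definition LDP :: "real \<Rightarrow> 'x set \<Rightarrow> 'z set \<Rightarrow> ('x \<Rightarrow> 'z pmf) \<Rightarrow> bool" where
  "LDP \<alpha> X Z q \<longleftrightarrow>
     (\<forall>x\<in>X. \<forall>x'\<in>X. \<forall>z\<in>Z. pmf (q x) z \<le> exp \<alpha> * pmf (q x') z)"

definition extremal :: "real \<Rightarrow> 'x set \<Rightarrow> 'z set \<Rightarrow> ('x \<Rightarrow> 'z pmf) \<Rightarrow> bool" where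
  "extremal \<alpha> X Z q \<longleftrightarrow>
     (\<forall>z\<in>Z. \<forall>x\<in>X. \<forall>x'\<in>X.
        if pmf (q x) z = 0 then pmf (q x') z = 0
        else pmf (q x') z / pmf (q x) z \<in> {exp (- \<alpha>), 1, exp \<alpha>})"

definition comp_mechanism :: "('e \<Rightarrow> 'z pmf) \<Rightarrow> ('x \<Rightarrow> 'e pmf) \<Rightarrow> 'x \<Rightarrow> 'z pmf" where
  "comp_mechanism q2 q1 x = bind_pmf (q1 x) q2"

lemma pmf_comp_mechanism:
  assumes "mechanism X E q1" "finite E" "x \<in> X"
  shows "pmf (comp_mechanism q2 q1 x) z = (\<Sum>y\<in>E. pmf (q1 x) y * pmf (q2 y) z)"
  using assms unfolding comp_mechanism_def mechanism_def pmf_bind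
  by (subst integral_measure_pmf[of E]) auto

text \<open>
  The points of the source are enumerated as \<open>x 1, \<dots>, x d\<close>; the value of the staircase pattern
  \<open>\<beta>\<close> at \<open>x (j + 1)\<close> is governed by the binary digit number \<open>j\<close> of \<open>\<beta>\<close>.
\<close>

definition staircase :: "real \<Rightarrow> nat \<Rightarrow> (nat \<Rightarrow> 'x) \<Rightarrow> nat \<Rightarrow> 'x \<Rightarrow> real" where
  "staircase \<alpha> d x \<beta> y = (if bit \<beta> (inv_into {1..d} x y - 1) then exp \<alpha> else 1)"

lemma staircase_enum:
  assumes "inj_on x {1..d}" "j < d"
  shows "staircase \<alpha> d x \<beta> (x (j + 1)) = (if bit \<beta> j then exp \<alpha> else 1)"
  using assms by (simp add: staircase_def inv_into_f_f)

lemma binary_expansion: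
  fixes \<beta> :: nat
  assumes "\<beta> < 2 ^ d"
  shows "\<beta> = (\<Sum>j<d. of_bool (bit \<beta> j) * 2 ^ j)"
proof -
  have "take_bit d \<beta> = \<beta>"
    using assms by (simp add: take_bit_nat_eq_self_iff)
  then show ?thesis
    by (metis (no_types, lifting) take_bit_sum push_bit_of_1 push_bit_eq_mult mult.commute sum.cong lessThan_atLeast0)
qed

end

theory Submission
  imports Defs
begin

text \<open>
  Fix an output \<open>z\<close>. The LDP condition says that the column \<open>y \<mapsto> q y z\<close> takes its values in an
  interval \<open>[m, exp \<alpha> * m]\<close>, so after an affine rescaling it is a point of the unit cube with one
  coordinate for each point of the source. Such a point is a convex combination of the vertices of
  the cube, that is, the column is a nonnegative combination of the staircase patterns, say with
  coefficients \<open>c z \<beta>\<close> (lemma \<open>staircase_cone\<close>; the weights are the probabilities of the vertices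
  when the coordinates are drawn as independent Bernoulli variables).

  Put \<open>\<omega> \<beta> = (\<Sum>z\<in>Z. c z \<beta>)\<close>. Then \<open>q1 y \<beta> = \<omega> \<beta> * staircase \<alpha> d x \<beta> y\<close> has total mass
  \<open>(\<Sum>z\<in>Z. q y z) = 1\<close>, and \<open>q2 \<beta> z = c z \<beta> / \<omega> \<beta>\<close> distributes the mass of the pattern \<open>\<beta>\<close> over the
  outputs in such a way that the composition returns \<open>q\<close>. The bounds on the mass of \<open>\<omega>\<close> follow from
  \<open>(\<Sum>\<beta><2 ^ d. q1 y \<beta>) = 1\<close> because the patterns take values between \<open>1\<close> and \<open>exp \<alpha>\<close>.
\<close>

lemma finite_weights_pmf:
  fixes f :: "'a \<Rightarrow> real"
  assumes "finite A" and nonneg: "\<And>a. a \<in> A \<Longrightarrow> 0 \<le> f a" and "sum f A = 1"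
  shows "\<exists>p. set_pmf p \<subseteq> A \<and> (\<forall>a\<in>A. pmf p a = f a)"
proof -
  define g where "g a = (if a \<in> A then f a else 0)" for a
  have g_nonneg: "0 \<le> g a" for a
    using nonneg by (simp add: g_def)
  have "(\<integral>\<^sup>+a. ennreal (g a) \<partial>count_space UNIV) = (\<Sum>a\<in>A. ennreal (g a))"
    using assms(1) by (intro nn_integral_count_space') (auto simp: g_def)
  also have "\<dots> = ennreal (\<Sum>a\<in>A. g a)"
    by (rule sum_ennreal) (rule g_nonneg)
  also have "(\<Sum>a\<in>A. g a) = 1"
    using assms(3) by (simp add: g_def)
  finally have pmf_g: "pmf (embed_pmf g) a = g a" for a
    using g_nonneg by (simp add: pmf_embed_pmf)
  have "set_pmf (embed_pmf g) \<subseteq> A"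
    by (auto simp: set_pmf_iff pmf_g g_def split: if_splits)
  moreover have "\<forall>a\<in>A. pmf (embed_pmf g) a = f a"
    by (simp add: pmf_g g_def)
  ultimately show ?thesis
    by blast
qed

lemma sum_lessThan_double:
  fixes g :: "nat \<Rightarrow> 'a::comm_monoid_add"
  shows "(\<Sum>i<2 * n. g i) = (\<Sum>i<n. g (2 * i) + g (2 * i + 1))"
  by (induction n) (simp_all add: ac_simps)

text \<open>Expansion of a product of binary sums, the summands being indexed by binary numbers.\<close>

lemma sum_prod_bits:
  fixes f :: "nat \<Rightarrow> bool \<Rightarrow> 'a::comm_semiring_1"
  shows "(\<Sum>\<beta><(2::nat) ^ d. \<Prod>j<d. f j (bit \<beta> j)) = (\<Prod>j<d. f j True + f j False)"
proof (induction d arbitrary: f)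
  case 0
  show ?case by simp
next
  case (Suc d)
  have "(\<Sum>\<beta><(2::nat) ^ Suc d. \<Prod>j<Suc d. f j (bit \<beta> j))
      = (\<Sum>\<beta><(2::nat) ^ d. (f 0 True + f 0 False) * (\<Prod>j<d. f (Suc j) (bit \<beta> j)))"
    unfolding power_Suc sum_lessThan_double
    by (simp add: prod.lessThan_Suc_shift bit_Suc bit_0 algebra_simps del: prod.lessThan_Suc)
  also have "\<dots> = (f 0 True + f 0 False) * (\<Prod>j<d. f (Suc j) True + f (Suc j) False)"
    using Suc.IH[of "\<lambda>j. f (Suc j)"] by (simp add: sum_distrib_left[symmetric])
  also have "\<dots> = (\<Prod>j<Suc d. f j True + f j False)"
    by (simp add: prod.lessThan_Suc_shift del: prod.lessThan_Suc)
  finally show ?case .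
qed

text \<open>
  The unit cube is the convex hull of its vertices. The weight of a vertex is its probability under
  independent Bernoulli variables with parameters \<open>u j\<close>.
\<close>

lemma cube_convex_combination:
  fixes u :: "nat \<Rightarrow> real"
  assumes u: "\<And>j. j < d \<Longrightarrow> 0 \<le> u j \<and> u j \<le> 1"
  shows "\<exists>w. (\<forall>\<beta>. 0 \<le> w \<beta>) \<and> (\<Sum>\<beta><(2::nat) ^ d. w \<beta>) = 1 \<and>
             (\<forall>k<d. (\<Sum>\<beta><(2::nat) ^ d. w \<beta> * of_bool (bit \<beta> k)) = u k)"
proof -
  define f where "f j b = (if b then u j else 1 - u j)" for j b
  define w where "w \<beta> = (\<Prod>j<d. f j (bit \<beta> j))" for \<beta> :: nat
  have "0 \<le> w \<beta>" for \<beta>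
    using u unfolding w_def by (intro prod_nonneg) (auto simp: f_def)
  moreover have "(\<Sum>\<beta><(2::nat) ^ d. w \<beta>) = 1"
    unfolding w_def sum_prod_bits by (simp add: f_def)
  moreover have "(\<Sum>\<beta><(2::nat) ^ d. w \<beta> * of_bool (bit \<beta> k)) = u k" if "k < d" for k
  proof -
    \<comment> \<open>Inserting the indicator of \<open>bit \<beta> k\<close> annihilates the summand \<open>1 - u k\<close> of the factor \<open>k\<close>.\<close>
    define g where "g j b = f j b * (if j = k then of_bool b else 1)" for j b
    have "w \<beta> * of_bool (bit \<beta> k) = (\<Prod>j<d. g j (bit \<beta> j))" for \<beta>
      using that by (simp add: g_def w_def prod.distrib)
    then have "(\<Sum>\<beta><(2::nat) ^ d. w \<beta> * of_bool (bit \<beta> k)) = (\<Prod>j<d. g j True + g j False)"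
      by (simp add: sum_prod_bits)
    also have "\<dots> = (\<Prod>j<d. if j = k then u k else 1)"
      by (intro prod.cong) (auto simp: g_def f_def)
    finally show ?thesis
      using that by simp
  qed
  ultimately show ?thesis
    by blast
qed

lemma staircase_cone:
  fixes v :: "nat \<Rightarrow> real"
  assumes "0 \<le> \<alpha>" and v: "\<And>j. j < d \<Longrightarrow> m \<le> v j \<and> v j \<le> exp \<alpha> * m" and "0 \<le> m"
  shows "\<exists>c. (\<forall>\<beta>. 0 \<le> c \<beta>) \<and>
             (\<forall>j<d. v j = (\<Sum>\<beta><(2::nat) ^ d. c \<beta> * (if bit \<beta> j then exp \<alpha> else 1)))"
proof -
  \<comment> \<open>If \<open>m = 0\<close> or \<open>\<alpha> = 0\<close>, then \<open>v\<close> is constantly \<open>m\<close>, and division by zero yields \<open>u = 0\<close>, as needed.\<close>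
  define u where "u j = (v j - m) / (m * (exp \<alpha> - 1))" for j
  have v_eq: "v j = m + m * (exp \<alpha> - 1) * u j" and u: "0 \<le> u j \<and> u j \<le> 1" if "j < d" for j
  proof -
    show "v j = m + m * (exp \<alpha> - 1) * u j"
      using v[OF that] by (cases "m * (exp \<alpha> - 1) = 0") (auto simp: u_def)
    have "0 \<le> m * (exp \<alpha> - 1)"
      using assms(1,3) by simp
    moreover have "0 \<le> v j - m" "v j - m \<le> m * (exp \<alpha> - 1)"
      using v[OF that] by (auto simp: algebra_simps)
    ultimately show "0 \<le> u j \<and> u j \<le> 1"
      unfolding u_def by (metis divide_nonneg_nonneg divide_le_eq_1 order_le_less div_by_0 zero_le_one)
  qed
  obtain w where w: "\<And>\<beta>. 0 \<le> w \<beta>" "(\<Sum>\<beta><(2::nat) ^ d. w \<beta>) = 1"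
    "\<And>k. k < d \<Longrightarrow> (\<Sum>\<beta><(2::nat) ^ d. w \<beta> * of_bool (bit \<beta> k)) = u k"
    using cube_convex_combination[of d u] u by blast
  have "v j = (\<Sum>\<beta><(2::nat) ^ d. m * w \<beta> * (if bit \<beta> j then exp \<alpha> else 1))" if "j < d" for j
  proof -
    have "(\<Sum>\<beta><(2::nat) ^ d. m * w \<beta> * (if bit \<beta> j then exp \<alpha> else 1))
        = (\<Sum>\<beta><(2::nat) ^ d. m * w \<beta> + m * (exp \<alpha> - 1) * (w \<beta> * of_bool (bit \<beta> j)))"
      by (intro sum.cong) (auto simp: algebra_simps)
    also have "\<dots> = m + m * (exp \<alpha> - 1) * u j"
      by (simp add: sum.distrib sum_distrib_left[symmetric] w(2) w(3)[OF that])
    finally show ?thesis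
      using v_eq[OF that] by simp
  qed
  moreover have "0 \<le> m * w \<beta>" for \<beta>
    using w(1) assms(3) by simp
  ultimately show ?thesis
    by (intro exI[of _ "\<lambda>\<beta>. m * w \<beta>"]) blast
qed

lemma LDP_column_decomposition:
  assumes "0 \<le> \<alpha>" and x: "bij_betw x {1..d} X" and ldp: "LDP \<alpha> X Z q" and "z \<in> Z"
  shows "\<exists>c. (\<forall>\<beta>. 0 \<le> c \<beta>) \<and>
             (\<forall>y\<in>X. pmf (q y) z = (\<Sum>\<beta><2 ^ d. c \<beta> * staircase \<alpha> d x \<beta> y))"
proof (cases "X = {}")
  case True
  then show ?thesis by (intro exI[of _ "\<lambda>_. 0"]) simp
next
  case False
  have "finite X"
    using bij_betw_finite[OF x] by simp
  then have "Min ((\<lambda>y. pmf (q y) z) ` X) \<in> (\<lambda>y. pmf (q y) z) ` X"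
    using False by (intro Min_in) auto
  then obtain y0 where y0: "y0 \<in> X" "pmf (q y0) z = Min ((\<lambda>y. pmf (q y) z) ` X)"
    by auto
  have min: "pmf (q y0) z \<le> pmf (q y) z" if "y \<in> X" for y
    unfolding y0(2) using that \<open>finite X\<close> by simp
  have mem: "x (j + 1) \<in> X" if "j < d" for j
    using bij_betwE[OF x] that by simp
  have "pmf (q y0) z \<le> pmf (q (x (j + 1))) z \<and>
        pmf (q (x (j + 1))) z \<le> exp \<alpha> * pmf (q y0) z" if "j < d" for j
    using min mem[OF that] ldp y0(1) \<open>z \<in> Z\<close> unfolding LDP_def by blast
  then have "\<exists>c. (\<forall>\<beta>. 0 \<le> c \<beta>) \<and> (\<forall>j<d. pmf (q (x (j + 1))) z =
               (\<Sum>\<beta><(2::nat) ^ d. c \<beta> * (if bit \<beta> j then exp \<alpha> else 1)))"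
    by (rule staircase_cone[OF assms(1) _ pmf_nonneg])
  then obtain c where c: "\<forall>\<beta>. 0 \<le> c \<beta>"
      "\<forall>j<d. pmf (q (x (j + 1))) z =
         (\<Sum>\<beta><(2::nat) ^ d. c \<beta> * (if bit \<beta> j then exp \<alpha> else 1))"
    by (elim exE conjE)
  have "pmf (q y) z = (\<Sum>\<beta><2 ^ d. c \<beta> * staircase \<alpha> d x \<beta> y)" if "y \<in> X" for y
  proof -
    have "y \<in> x ` {1..d}"
      using x that by (simp add: bij_betw_def)
    then obtain i where "i \<in> {1..d}" "y = x i"
      by blast
    then have "i - 1 < d" "y = x (i - 1 + 1)"
      by auto
    then obtain j where "j < d" "y = x (j + 1)"
      by blast
    then show ?thesis
      using c(2) staircase_enum[OF bij_betw_imp_inj_on[OF x]] by simp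
  qed
  then show ?thesis
    using c(1) by blast
qed

lemma staircase_bounds:
  assumes "0 \<le> \<alpha>"
  shows "1 \<le> staircase \<alpha> d x \<beta> y" and "staircase \<alpha> d x \<beta> y \<le> exp \<alpha>"
  using assms by (simp_all add: staircase_def)

lemma extremal_staircase:
  assumes "\<And>y \<beta>. y \<in> X \<Longrightarrow> \<beta> \<in> E \<Longrightarrow> pmf (q1 y) \<beta> = \<omega> \<beta> * staircase \<alpha> d x \<beta> y"
  shows "extremal \<alpha> X E q1"
  unfolding extremal_def using assms by (auto simp: staircase_def exp_minus field_simps)

theorem lemma1:
  fixes \<alpha> :: real and d :: nat and x :: "nat \<Rightarrow> 'x" and X :: "'x set" and Z :: "'z set"
    and q :: "'x \<Rightarrow> 'z pmf"
  assumes "0 \<le> \<alpha>"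
    and "bij_betw x {1..d} X"
    and "finite Z" and "Z \<noteq> {}"
    and "mechanism X Z q" and "LDP \<alpha> X Z q"
  shows "\<exists>(q1 :: 'x \<Rightarrow> nat pmf) (q2 :: nat \<Rightarrow> 'z pmf) (\<omega> :: nat \<Rightarrow> real).
           mechanism X {..<2 ^ d} q1 \<and> extremal \<alpha> X {..<2 ^ d} q1 \<and>
           mechanism {..<2 ^ d} Z q2 \<and>
           (\<forall>y\<in>X. q y = comp_mechanism q2 q1 y) \<and>
           (\<forall>y\<in>X. \<forall>\<beta><2 ^ d. pmf (q1 y) \<beta> = \<omega> \<beta> * staircase \<alpha> d x \<beta> y) \<and>
           (\<forall>\<beta><2 ^ d. 0 \<le> \<omega> \<beta>) \<and>
           exp (- \<alpha>) \<le> (\<Sum>\<beta><2 ^ d. \<omega> \<beta>) \<and> (\<Sum>\<beta><2 ^ d. \<omega> \<beta>) \<le> 1"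
proof (cases "X = {}")
  \<comment> \<open>An empty source imposes no condition on \<open>\<omega>\<close> other than its total mass.\<close>
  case True
  then have "d = 0"
    using bij_betw_same_card[OF assms(2)] by simp
  obtain z0 where "z0 \<in> Z"
    using assms(4) by blast
  then show ?thesis
    using True \<open>d = 0\<close> assms(1)
    by (intro exI[of _ "\<lambda>_. return_pmf 0"] exI[of _ "\<lambda>_. return_pmf z0"] exI[of _ "\<lambda>_. 1"])
       (simp add: mechanism_def extremal_def)
next
  case False
  then obtain y0 where y0: "y0 \<in> X"
    by blast
  let ?E = "{..<2 ^ d} :: nat set"
  let ?r = "staircase \<alpha> d x"
  have "\<forall>z\<in>Z. \<exists>c. (\<forall>\<beta>. 0 \<le> c \<beta>) \<and> (\<forall>y\<in>X. pmf (q y) z = (\<Sum>\<beta>\<in>?E. c \<beta> * ?r \<beta> y))"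
    using LDP_column_decomposition[OF assms(1,2,6)] by blast
  then obtain c where c_nonneg: "\<And>z \<beta>. z \<in> Z \<Longrightarrow> 0 \<le> c z \<beta>"
    and c_sum: "\<And>z y. z \<in> Z \<Longrightarrow> y \<in> X \<Longrightarrow> pmf (q y) z = (\<Sum>\<beta>\<in>?E. c z \<beta> * ?r \<beta> y)"
    by metis
  define \<omega> where "\<omega> \<beta> = (\<Sum>z\<in>Z. c z \<beta>)" for \<beta>
  have \<omega>_nonneg: "0 \<le> \<omega> \<beta>" for \<beta>
    unfolding \<omega>_def by (intro sum_nonneg c_nonneg)
  have total: "(\<Sum>\<beta>\<in>?E. \<omega> \<beta> * ?r \<beta> y) = 1" if "y \<in> X" for y
  proof -
    have "(\<Sum>\<beta>\<in>?E. \<omega> \<beta> * ?r \<beta> y) = (\<Sum>\<beta>\<in>?E. \<Sum>z\<in>Z. c z \<beta> * ?r \<beta> y)"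
      by (simp add: \<omega>_def sum_distrib_right)
    also have "\<dots> = (\<Sum>z\<in>Z. \<Sum>\<beta>\<in>?E. c z \<beta> * ?r \<beta> y)"
      by (rule sum.swap)
    also have "\<dots> = (\<Sum>z\<in>Z. pmf (q y) z)"
      using c_sum that by simp
    also have "\<dots> = 1"
      using assms(3,5) that by (intro sum_pmf_eq_1) (auto simp: mechanism_def)
    finally show ?thesis .
  qed
  have r_pos: "0 \<le> ?r \<beta> y" for \<beta> y
    using staircase_bounds(1)[OF assms(1)] by (rule order_trans[OF zero_le_one])
  have "\<exists>p. set_pmf p \<subseteq> ?E \<and> (\<forall>\<beta>\<in>?E. pmf p \<beta> = \<omega> \<beta> * ?r \<beta> y)" if "y \<in> X" for y
    using total[OF that] \<omega>_nonneg r_pos by (intro finite_weights_pmf) auto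
  then obtain q1 where q1_supp: "\<And>y. y \<in> X \<Longrightarrow> set_pmf (q1 y) \<subseteq> ?E"
    and q1: "\<And>y \<beta>. y \<in> X \<Longrightarrow> \<beta> \<in> ?E \<Longrightarrow> pmf (q1 y) \<beta> = \<omega> \<beta> * ?r \<beta> y"
    by metis
  have "\<exists>p. set_pmf p \<subseteq> Z \<and> (\<forall>z\<in>Z. \<omega> \<beta> * pmf p z = c z \<beta>)" for \<beta>
  proof (cases "\<omega> \<beta> = 0")
    \<comment> \<open>The pattern \<open>\<beta>\<close> has no mass, so any distribution on \<open>Z\<close> will do.\<close>
    case True
    then have "\<forall>z\<in>Z. c z \<beta> = 0"
      using assms(3) c_nonneg by (simp add: \<omega>_def sum_nonneg_eq_0_iff)
    moreover obtain z0 where "z0 \<in> Z"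
      using assms(4) by blast
    ultimately show ?thesis
      using True by (intro exI[of _ "return_pmf z0"]) simp
  next
    case False
    have "(\<Sum>z\<in>Z. c z \<beta> / \<omega> \<beta>) = 1"
      using False by (simp add: sum_divide_distrib[symmetric] \<omega>_def)
    then have "\<exists>p. set_pmf p \<subseteq> Z \<and> (\<forall>z\<in>Z. pmf p z = c z \<beta> / \<omega> \<beta>)"
      using assms(3) c_nonneg \<omega>_nonneg by (intro finite_weights_pmf) auto
    then show ?thesis
      using False by auto
  qed
  then obtain q2 where q2_supp: "\<And>\<beta>. set_pmf (q2 \<beta>) \<subseteq> Z"
    and q2: "\<And>\<beta> z. z \<in> Z \<Longrightarrow> \<omega> \<beta> * pmf (q2 \<beta>) z = c z \<beta>"
    by metis
  have mech1: "mechanism X ?E q1"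
    using q1_supp by (simp add: mechanism_def)
  have "q y = comp_mechanism q2 q1 y" if y: "y \<in> X" for y
  proof (rule pmf_eqI)
    fix z
    have comp: "pmf (comp_mechanism q2 q1 y) z = (\<Sum>\<beta>\<in>?E. \<omega> \<beta> * pmf (q2 \<beta>) z * ?r \<beta> y)"
      using pmf_comp_mechanism[OF mech1 _ y] q1[OF y] by (simp add: mult_ac)
    show "pmf (q y) z = pmf (comp_mechanism q2 q1 y) z"
    proof (cases "z \<in> Z")
      case True
      then show ?thesis
        by (simp add: comp q2 c_sum y)
    next
      case False
      have "pmf (q y) z = 0" and "\<And>\<beta>. pmf (q2 \<beta>) z = 0"
        using False assms(5) y q2_supp by (auto simp: mechanism_def pmf_eq_0_set_pmf)
      then show ?thesis
        by (simp add: comp)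
    qed
  qed
  moreover have "exp (- \<alpha>) \<le> (\<Sum>\<beta>\<in>?E. \<omega> \<beta>)"
  proof -
    have "(\<Sum>\<beta>\<in>?E. \<omega> \<beta> * ?r \<beta> y0) \<le> (\<Sum>\<beta>\<in>?E. \<omega> \<beta> * exp \<alpha>)"
      by (intro sum_mono mult_left_mono staircase_bounds(2) \<omega>_nonneg assms(1))
    then show ?thesis
      by (simp add: total[OF y0] sum_distrib_right[symmetric] exp_minus divide_simps)
  qed
  moreover have "(\<Sum>\<beta>\<in>?E. \<omega> \<beta>) \<le> 1"
  proof -
    have "(\<Sum>\<beta>\<in>?E. \<omega> \<beta> * 1) \<le> (\<Sum>\<beta>\<in>?E. \<omega> \<beta> * ?r \<beta> y0)"
      by (intro sum_mono mult_left_mono staircase_bounds(1) \<omega>_nonneg assms(1))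
    then show ?thesis
      by (simp add: total[OF y0])
  qed
  moreover have "mechanism ?E Z q2"
    using q2_supp by (simp add: mechanism_def)
  moreover have "extremal \<alpha> X ?E q1"
    using q1 by (rule extremal_staircase)
  ultimately show ?thesis
    using mech1 q1 \<omega>_nonneg
    by (intro exI[of _ q1] exI[of _ q2] exI[of _ \<omega>]) auto
qed

end
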